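(* Let $k$ be a field. Then $UT_2(k)$ contains a free subsemigroup of rank $2$ if and only if $k$ is not locally finite.
   Context: $UT_2(k)$ is the monoid of $2\times 2$ upper triangular matrices over $k$ under matrix multiplication (matrices are not required to be invertible). A field is locally finite if every finitely generated subfield is finite. *)

theory Defs
  imports
    "Jordan_Normal_Form.Matrix"
    "HOL-Algebra.Generated_Fields"
    "HOL-Algebra.Algebraic_Closure_Type"
begin

definition UT :: "'a::field itself \<Rightarrow> nat \<Rightarrow> 'a mat monoid" where
  "UT ty n = \<lparr>carrier = {A \<in> carrier_mat n n. upper_triangular A},
              monoid.mult = (*), one = 1\<^sub>m n\<rparr>"

definition locally_finite_field :: "('a, 'm) ring_scheme \<Rightarrow> bool" where
  "locally_finite_field K \<longleftrightarrow>
     (\<forall>S. S \<subseteq> carrier K \<and> finite S \<longrightarrow> finite (generate_field K S))"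

definition subsemigroup :: "'a set \<Rightarrow> ('a, 'm) monoid_scheme \<Rightarrow> bool" where
  "subsemigroup T M \<longleftrightarrow>
     T \<subseteq> carrier M \<and> (\<forall>x\<in>T. \<forall>y\<in>T. x \<otimes>\<^bsub>M\<^esub> y \<in> T)"

(* Free semigroup, not monoid: the empty word is excluded. The operation is (@). *)
definition free_semigroup :: "'x set \<Rightarrow> 'x list set" where
  "free_semigroup A = lists A - {[]}"

definition free_subsemigroup :: "nat \<Rightarrow> 'a set \<Rightarrow> ('a, 'm) monoid_scheme \<Rightarrow> bool" where
  "free_subsemigroup r T M \<longleftrightarrow>
     subsemigroup T M \<and>
     (\<exists>\<phi>. bij_betw \<phi> (free_semigroup {..<r}) T \<and>
          (\<forall>u\<in>free_semigroup {..<r}. \<forall>v\<in>free_semigroup {..<r}.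
             \<phi> (u @ v) = \<phi> u \<otimes>\<^bsub>M\<^esub> \<phi> v))"

end

theory Submission
  imports Defs "HOL-Number_Theory.Cong"
begin

text \<open>
  The dividing line between the two cases is whether every element of the field is a root of a
  nonzero polynomial with coefficients in \<open>{-1, 0, 1}\<close>.

  If some \<open>t\<close> is not such a root, then the affine maps \<open>x \<mapsto> t * x\<close> and \<open>x \<mapsto> t * x + 1\<close> generate a free
  semigroup: the product along a word \<open>u\<close> of zeros and ones is \<open>x \<mapsto> t ^ n * x + (\<Sum>i<n. u ! i * t ^ i)\<close>
  with \<open>n = length u\<close>, and two distinct words with the same product would yield a nontrivial relation
  for \<open>t\<close> with coefficients in \<open>{-1, 0, 1}\<close> (lemmas \<open>word_matrix_append\<close> and \<open>inj_word_matrix\<close>).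

  If every element is such a root, then applying this to \<open>2\<close> rules out characteristic \<open>0\<close>, so the
  integers have a finite image in the field. The relations are integral, since their leading
  coefficient is a unit; hence adjoining an element to a finite subring gives a finite ring again,
  and every finite set lies in a finite subring. A finite subring of a field is a subfield,
  so the field is locally finite (lemma \<open>locally_finite_if_all_signed_binary_roots\<close>).

  Conversely, if the field is locally finite, then the powers of one generator all have entries in
  the finite field generated by the entries of that generator; so there are only finitely many of
  them, whereas a nonempty word of a free semigroup has infinitely many powers.
\<close>

section \<open>Finite subrings of a field\<close>

definition unital_subring :: "'k::field set \<Rightarrow> bool" where
  "unital_subring R \<longleftrightarrow> 1 \<in> R \<and> (\<forall>x\<in>R. \<forall>y\<in>R. x - y \<in> R \<and> x * y \<in> R)"

lemma unital_subringD:
  assumes "unital_subring R"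
  shows "1 \<in> R" "0 \<in> R" "x \<in> R \<Longrightarrow> - x \<in> R"
    "x \<in> R \<Longrightarrow> y \<in> R \<Longrightarrow> x - y \<in> R" "x \<in> R \<Longrightarrow> y \<in> R \<Longrightarrow> x + y \<in> R"
    "x \<in> R \<Longrightarrow> y \<in> R \<Longrightarrow> x * y \<in> R"
proof -
  show 1: "1 \<in> R" and diff: "\<And>x y. x \<in> R \<Longrightarrow> y \<in> R \<Longrightarrow> x - y \<in> R"
    and "x \<in> R \<Longrightarrow> y \<in> R \<Longrightarrow> x * y \<in> R"
    using assms by (auto simp: unital_subring_def)
  show 0: "0 \<in> R" using diff[OF 1 1] by simp
  show neg: "\<And>x. x \<in> R \<Longrightarrow> - x \<in> R" using diff[OF 0] by fastforce
  show "x \<in> R \<Longrightarrow> y \<in> R \<Longrightarrow> x + y \<in> R" using diff[OF _ neg, of x y] by simp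
qed

lemma unital_subring_sum:
  assumes "unital_subring R" "\<And>i. i \<in> I \<Longrightarrow> f i \<in> R"
  shows "sum f I \<in> R"
  using assms(2) by (induction I rule: infinite_finite_induct)
    (auto intro: unital_subringD[OF assms(1)])

text \<open>Multiplication by a nonzero element is injective, hence permutes the finite subring and hits \<open>1\<close>.\<close>

lemma finite_subring_inverse_closed:
  assumes "unital_subring R" "finite R" "x \<in> R" "x \<noteq> 0"
  shows "inverse x \<in> R"
proof -
  have "inj_on ((*) x) R" using assms(4) by (auto intro: inj_onI)
  moreover have "(*) x ` R \<subseteq> R" using unital_subringD(6)[OF assms(1) assms(3)] by auto
  ultimately have "(*) x ` R = R" using endo_inj_surj[OF assms(2)] by blast
  then have "1 \<in> (*) x ` R" using unital_subringD(1)[OF assms(1)] by simp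
  then obtain y where "y \<in> R" "x * y = 1" by auto
  then show ?thesis using inverse_unique by metis
qed

lemma ring_of_type_algebra_ops:
  fixes x y :: "'k::field"
  shows "x \<otimes>\<^bsub>ring_of_type_algebra\<^esub> y = x * y" "x \<oplus>\<^bsub>ring_of_type_algebra\<^esub> y = x + y"
    "\<zero>\<^bsub>ring_of_type_algebra\<^esub> = (0 :: 'k)" "\<one>\<^bsub>ring_of_type_algebra\<^esub> = (1 :: 'k)"
    "\<ominus>\<^bsub>ring_of_type_algebra\<^esub> x = - x" "x \<noteq> 0 \<Longrightarrow> inv\<^bsub>ring_of_type_algebra\<^esub> x = inverse x"
proof -
  let ?K = "ring_of_type_algebra :: 'k ring"
  interpret K: field ?K by (rule field_from_type_algebra)
  show ops: "x \<otimes>\<^bsub>?K\<^esub> y = x * y" "x \<oplus>\<^bsub>?K\<^esub> y = x + y" "\<zero>\<^bsub>?K\<^esub> = 0" "\<one>\<^bsub>?K\<^esub> = 1" for x y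
    by (simp_all only: ring_of_type_algebra_def monoid.simps ring.simps)
  have carrier: "z \<in> carrier ?K" for z
    by (simp only: ring_of_type_algebra_def partial_object.simps UNIV_I)
  show "\<ominus>\<^bsub>?K\<^esub> x = - x"
    by (rule K.minus_equality[OF _ carrier carrier]) (simp only: ops left_minus)
  show "inv\<^bsub>?K\<^esub> x = inverse x" if "x \<noteq> 0"
    by (rule K.comm_inv_char[OF carrier carrier]) (simp only: ops right_inverse[OF that])
qed

lemma generate_field_subset_finite_subring:
  fixes S R :: "'k::field set"
  assumes R: "unital_subring R" "finite R" and "S \<subseteq> R"
  shows "generate_field (ring_of_type_algebra :: 'k ring) S \<subseteq> R"
proof
  fix x assume "x \<in> generate_field (ring_of_type_algebra :: 'k ring) S"
  then show "x \<in> R"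
    by induction (use \<open>S \<subseteq> R\<close> in \<open>auto simp: ring_of_type_algebra_ops
        intro: unital_subringD[OF R(1)] finite_subring_inverse_closed[OF R]\<close>)
qed

section \<open>Adjoining integral elements\<close>

definition adjoin :: "'k::field set \<Rightarrow> 'k \<Rightarrow> 'k set" where
  "adjoin R t = {poly q t | q. \<forall>n. coeff q n \<in> R}"

lemma adjoinI: "(\<And>n. coeff q n \<in> R) \<Longrightarrow> x = poly q t \<Longrightarrow> x \<in> adjoin R t"
  unfolding adjoin_def by blast

lemma unital_subring_adjoin:
  assumes R: "unital_subring R"
  shows "unital_subring (adjoin R t)"
  unfolding unital_subring_def
proof (intro conjI ballI)
  show "1 \<in> adjoin R t"
    using unital_subringD(1,2)[OF R] by (intro adjoinI[of 1]) (auto simp: coeff_1)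
next
  fix x y assume "x \<in> adjoin R t" "y \<in> adjoin R t"
  then obtain p q where pq: "x = poly p t" "\<And>n. coeff p n \<in> R" "y = poly q t" "\<And>n. coeff q n \<in> R"
    by (auto simp: adjoin_def)
  show "x - y \<in> adjoin R t"
    using pq unital_subringD(4)[OF R] by (intro adjoinI[of "p - q"]) auto
  have "coeff (p * q) n \<in> R" for n
    unfolding coeff_mult
    by (intro unital_subring_sum[OF R] unital_subringD(6)[OF R] pq(2,4))
  then show "x * y \<in> adjoin R t"
    using pq by (intro adjoinI[of "p * q"]) auto
qed

lemma subset_adjoin:
  assumes R: "unital_subring R"
  shows "R \<subseteq> adjoin R t" "t \<in> adjoin R t"
proof -
  show "R \<subseteq> adjoin R t"
  proof
    fix r assume "r \<in> R"
    then show "r \<in> adjoin R t"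
      using unital_subringD(2)[OF R]
      by (intro adjoinI[of "[:r:]"]) (auto simp: coeff_pCons split: nat.split)
  qed
  show "t \<in> adjoin R t"
    using unital_subringD(1,2)[OF R]
    by (intro adjoinI[of "[:0, 1:]"]) (auto simp: coeff_pCons split: nat.split)
qed

text \<open>
  Since the leading coefficient of the relation \<open>p\<close> is a unit of \<open>R\<close>, division with remainder by \<open>p\<close>
  stays inside \<open>R\<close>. So a value of a polynomial over \<open>R\<close> at \<open>t\<close> is already the value of one of degree
  below \<open>degree p\<close>, and there are only finitely many of those.
\<close>

lemma finite_adjoin:
  assumes R: "unital_subring R" "finite R"
    and p: "\<forall>n. coeff p n \<in> R" "p \<noteq> 0" "lead_coeff p \<in> {-1, 1}" "poly p t = 0"
  shows "finite (adjoin R t)"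
proof -
  have reduce: "\<exists>xs. set xs \<subseteq> R \<and> length xs \<le> degree p \<and> poly q t = poly (Poly xs) t"
    if "\<forall>n. coeff q n \<in> R" for q
    using that
  proof (induction "length (coeffs q)" arbitrary: q rule: less_induct)
    case less
    show ?case
    proof (cases "q = 0 \<or> degree q < degree p")
      case True
      then have "length (coeffs q) \<le> degree p"
        by (cases "q = 0") (simp_all add: length_coeffs_degree)
      moreover have "set (coeffs q) \<subseteq> R" using less.prems
        by (cases "q = 0") (auto simp: coeffs_def)
      ultimately show ?thesis by (intro exI[of _ "coeffs q"]) simp
    next
      case False
      define c where "c = lead_coeff q * lead_coeff p"
      define q' where "q' = q - monom c (degree q - degree p) * p"
      have "c \<in> R"
        unfolding c_def using less.prems p(1) by (intro unital_subringD(6)[OF R(1)]) blast+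
      moreover have "c * lead_coeff p = lead_coeff q"
        using p(3) by (auto simp: c_def)
      ultimately have c: "c \<in> R" "c * lead_coeff p = lead_coeff q" .
      have coeff': "coeff q' n = coeff q n -
          (if n < degree q - degree p then 0 else c * coeff p (n - (degree q - degree p)))" for n
        by (simp add: q'_def coeff_monom_mult)
      have R': "\<forall>n. coeff q' n \<in> R"
        unfolding coeff' using less.prems p(1) c(1)
        by (auto intro!: unital_subringD(4,6)[OF R(1)])
      have "coeff q' n = 0" if "n \<ge> degree q" for n
      proof (cases "n = degree q")
        case True
        then show ?thesis using False c(2) by (simp add: coeff')
      next
        case ne: False
        then have "coeff q n = 0" "coeff p (n - (degree q - degree p)) = 0"
          using that False ne by (auto intro!: coeff_eq_0)
        then show ?thesis by (simp add: coeff')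
      qed
      then have "q' = 0 \<or> degree q' < degree q"
        by (metis leading_coeff_0_iff not_le)
      then have "length (coeffs q') < length (coeffs q)"
        using False by (cases "q' = 0") (simp_all add: length_coeffs_degree)
      moreover have "poly q' t = poly q t" by (simp add: q'_def p(4))
      ultimately show ?thesis using less.hyps[OF _ R'] by simp
    qed
  qed
  have "adjoin R t \<subseteq> (\<lambda>xs. poly (Poly xs) t) ` {xs. set xs \<subseteq> R \<and> length xs \<le> degree p}"
  proof
    fix x assume "x \<in> adjoin R t"
    then obtain q where "x = poly q t" "\<forall>n. coeff q n \<in> R" unfolding adjoin_def by blast
    then show "x \<in> (\<lambda>xs. poly (Poly xs) t) ` {xs. set xs \<subseteq> R \<and> length xs \<le> degree p}"
      using reduce[of q] by blast
  qed
  then show ?thesis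
    using finite_subset finite_imageI[OF finite_lists_length_le[OF R(2)]] by blast
qed

section \<open>Roots of polynomials with coefficients in \<open>{-1, 0, 1}\<close>\<close>

definition signed_binary_root :: "'k::field \<Rightarrow> bool" where
  "signed_binary_root t \<longleftrightarrow> (\<exists>p. p \<noteq> 0 \<and> (\<forall>n. coeff p n \<in> {-1, 0, 1}) \<and> poly p t = 0)"

text \<open>Modulo \<open>2\<close> such a relation for \<open>2\<close> forces the constant coefficient to vanish; then divide by \<open>2\<close>.\<close>

lemma not_signed_binary_root_2:
  assumes char: "CHAR('k::field) = 0"
  shows "\<not> signed_binary_root (2 :: 'k)"
proof -
  have "(\<exists>z. poly p (2 :: 'k) = of_int z) \<and> (poly p 2 = 0 \<longrightarrow> p = 0)"
    if "\<forall>n. coeff p n \<in> {-1, 0, 1}" for p :: "'k poly"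
    using that
  proof (induction p)
    case 0
    show ?case by (auto intro: exI[of _ 0])
  next
    case (pCons a p)
    have "\<forall>n. coeff p n \<in> {-1, 0, 1}"
      using pCons.prems by (metis coeff_pCons_Suc)
    then obtain z where z: "poly p 2 = of_int z" and p0: "poly p 2 = 0 \<longrightarrow> p = 0"
      using pCons.IH by blast
    have "a \<in> {-1, 0, 1}" using pCons.prems by (metis coeff_pCons_0)
    then obtain b :: int where b: "b \<in> {-1, 0, 1}" "a = of_int b"
      by (metis insert_iff of_int_0 of_int_1 of_int_minus singletonD)
    have val: "poly (pCons a p) 2 = of_int (b + 2 * z)" by (simp add: z b)
    have "pCons a p = 0" if "poly (pCons a p) 2 = 0"
    proof -
      have "b + 2 * z = 0"
        using that char unfolding val of_int_eq_0_iff_char_dvd by simp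
      moreover have "b = -1 \<or> b = 0 \<or> b = 1" using b(1) by blast
      ultimately have "b = 0" "z = 0" by presburger+
      then show ?thesis using p0 z b by simp
    qed
    then show ?case using val by blast
  qed
  then show ?thesis unfolding signed_binary_root_def by blast
qed

lemma finite_range_of_int:
  assumes "CHAR('k::field) > 0"
  shows "finite (range (of_int :: int \<Rightarrow> 'k))"
proof -
  have "(of_int z :: 'k) \<in> of_int ` {0..<int CHAR('k)}" for z :: int
  proof -
    have "(of_int z :: 'k) = of_int (z mod int CHAR('k))"
      by (simp add: of_int_eq_iff_cong_CHAR cong_def)
    moreover have "z mod int CHAR('k) \<in> {0..<int CHAR('k)}" using assms by simp
    ultimately show ?thesis by (rule image_eqI)
  qed
  then have "range (of_int :: int \<Rightarrow> 'k) \<subseteq> of_int ` {0..<int CHAR('k)}" by blast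
  then show ?thesis by (rule finite_subset) simp
qed

lemma finite_set_in_finite_subring:
  fixes S :: "'k::field set"
  assumes roots: "\<And>t :: 'k. signed_binary_root t" and "finite S"
  shows "\<exists>R. unital_subring R \<and> finite R \<and> S \<subseteq> R"
  using \<open>finite S\<close>
proof (induction S)
  case empty
  have "CHAR('k) > 0" using roots not_signed_binary_root_2 by blast
  then have "finite (range (of_int :: int \<Rightarrow> 'k))" by (rule finite_range_of_int)
  moreover have "unital_subring (range (of_int :: int \<Rightarrow> 'k))"
    unfolding unital_subring_def Ints_def[symmetric] by auto
  ultimately show ?case by blast
next
  case (insert t S)
  then obtain R where R: "unital_subring R" "finite R" "S \<subseteq> R" by blast
  obtain p where p: "p \<noteq> 0" "\<forall>n. coeff p n \<in> {-1, 0, 1}" "poly p t = 0"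
    using roots[of t] unfolding signed_binary_root_def by blast
  have "{-1, 0, 1} \<subseteq> R" using unital_subringD(1-3)[OF R(1)] by blast
  then have "\<forall>n. coeff p n \<in> R" using p(2) by blast
  moreover have "lead_coeff p \<in> {-1, 1}"
    using p(1,2) by (metis insert_iff leading_coeff_0_iff)
  ultimately have "finite (adjoin R t)" using finite_adjoin[OF R(1,2)] p(1,3) by blast
  then show ?case
    using unital_subring_adjoin[OF R(1)] subset_adjoin[OF R(1)] R(3) by blast
qed

lemma locally_finite_if_all_signed_binary_roots:
  assumes "\<And>t :: 'k::field. signed_binary_root t"
  shows "locally_finite_field (ring_of_type_algebra :: 'k ring)"
  unfolding locally_finite_field_def
  using finite_set_in_finite_subring[OF assms] generate_field_subset_finite_subring
  by (metis finite_subset)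

section \<open>The free semigroup of affine maps\<close>

lemma index_mult_mat_2:
  assumes "A \<in> carrier_mat 2 2" "B \<in> carrier_mat 2 2" "i < 2" "j < 2"
  shows "(A * B) $$ (i, j) = A $$ (i, 0) * B $$ (0, j) + A $$ (i, 1) * B $$ (1, j)"
  using assms by (simp add: scalar_prod_def numeral_2_eq_2)

text \<open>
  The affine map \<open>x \<mapsto> t * x + b\<close> is encoded by the rows \<open>(t, b)\<close> and \<open>(0, 1)\<close>. The translation part
  of a product along a word is the Horner sum of its letters, read as digits in base \<open>t\<close>.
\<close>

definition word_matrix :: "'k::field \<Rightarrow> nat list \<Rightarrow> 'k mat" where
  "word_matrix t u = mat 2 2 (\<lambda>(i, j).
     if i = 0 then (if j = 0 then t ^ length u else horner_sum of_nat t u) else of_nat j)"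

lemma word_matrix_in_UT: "word_matrix t u \<in> carrier (UT TYPE('k::field) 2)"
  by (auto simp: UT_def word_matrix_def upper_triangular_def less_2_cases_iff)

lemma word_matrix_append: "word_matrix t (u @ v) = word_matrix t u * word_matrix t v"
proof (rule eq_matI)
  fix i j assume "i < dim_row (word_matrix t u * word_matrix t v)"
    "j < dim_col (word_matrix t u * word_matrix t v)"
  then have ij: "i < 2" "j < 2" by (simp_all add: word_matrix_def)
  have "word_matrix t w \<in> carrier_mat 2 2" for w by (simp add: word_matrix_def)
  note entry = index_mult_mat_2[OF this this ij]
  show "word_matrix t (u @ v) $$ (i, j) = (word_matrix t u * word_matrix t v) $$ (i, j)"
    unfolding entry using ij
    by (auto simp: less_2_cases_iff word_matrix_def horner_sum_append power_add)
qed (simp_all add: word_matrix_def)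

lemma poly_Poly_map: "poly (Poly (map f u)) t = horner_sum f t u"
  by (induction u) (auto simp: algebra_simps)

text \<open>
  The diagonal entry determines the length of the word, because \<open>X ^ m - X ^ n\<close> is a polynomial with
  coefficients in \<open>{-1, 0, 1}\<close>; the remaining entry then determines the digits.
\<close>

lemma inj_word_matrix:
  fixes t :: "'k::field"
  assumes "\<not> signed_binary_root t"
  shows "inj_on (word_matrix t) (lists {..<2})"
proof (rule inj_onI)
  fix u v :: "nat list"
  assume u: "u \<in> lists {..<2}" and v: "v \<in> lists {..<2}" and eq: "word_matrix t u = word_matrix t v"
  have zero: "p = 0" if "\<forall>n. coeff p n \<in> {-1, 0, 1}" "poly p t = 0" for p
    using assms that unfolding signed_binary_root_def by blast
  have pow: "t ^ length u = t ^ length v"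
    using arg_cong[OF eq, of "\<lambda>A. A $$ (0, 0)"] by (simp add: word_matrix_def)
  have sums: "horner_sum of_nat t u = horner_sum of_nat t v"
    using arg_cong[OF eq, of "\<lambda>A. A $$ (0, 1)"] by (simp add: word_matrix_def)
  have "monom 1 (length u) - monom 1 (length v) = (0 :: 'k poly)"
    using pow by (intro zero) (auto simp: poly_monom)
  then have len: "length u = length v" by (simp add: monom_eq_iff')
  define p where "p = Poly (map of_nat u) - (Poly (map of_nat v) :: 'k poly)"
  have digit: "nth_default 0 (map of_nat w) n \<in> {0, 1 :: 'k}" if "w \<in> lists {..<2}" for w :: "nat list" and n
  proof (cases "n < length w")
    case True
    then have "w ! n \<in> {..<2}" using that by (metis in_lists_conv_set nth_mem)
    then show ?thesis using True by (auto simp: nth_default_nth less_2_cases_iff)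
  qed (simp add: nth_default_beyond)
  have "p = 0"
  proof (rule zero)
    show "\<forall>n. coeff p n \<in> {-1, 0, 1}"
    proof
      fix n
      show "coeff p n \<in> {-1, 0, 1}"
        using digit[OF u, of n] digit[OF v, of n] by (auto simp: p_def)
    qed
    show "poly p t = 0" using sums by (simp add: p_def poly_Poly_map)
  qed
  then have coeffs: "nth_default 0 (map of_nat u) n = (nth_default 0 (map of_nat v) n :: 'k)" for n
    unfolding p_def by (metis coeff_Poly_eq eq_iff_diff_eq_0)
  show "u = v"
  proof (rule nth_equalityI[OF len])
    fix n assume n: "n < length u"
    then have "of_nat (u ! n) = (of_nat (v ! n) :: 'k)"
      using coeffs[of n] len by (simp add: nth_default_nth)
    moreover have "u ! n \<in> {..<2}" "v ! n \<in> {..<2}"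
      using u v n len by (metis in_lists_conv_set nth_mem)+
    ultimately show "u ! n = v ! n" by (auto simp: less_2_cases_iff)
  qed
qed

lemma free_subsemigroup_if_not_signed_binary_root:
  fixes t :: "'k::field"
  assumes "\<not> signed_binary_root t"
  shows "free_subsemigroup 2 (word_matrix t ` free_semigroup {..<2}) (UT TYPE('k) 2)"
proof -
  have mult: "A \<otimes>\<^bsub>UT TYPE('k) 2\<^esub> B = A * B" for A B by (simp add: UT_def)
  have closed: "u @ v \<in> free_semigroup {..<2}"
    if "u \<in> free_semigroup {..<2}" "v \<in> free_semigroup {..<2}" for u v :: "nat list"
    using that by (auto simp: free_semigroup_def)
  have "subsemigroup (word_matrix t ` free_semigroup {..<2}) (UT TYPE('k) 2)"
    unfolding subsemigroup_def mult
    using word_matrix_in_UT closed by (auto simp: word_matrix_append[symmetric])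
  moreover have "inj_on (word_matrix t) (free_semigroup {..<2})"
    using inj_word_matrix[OF assms] by (rule inj_on_subset) (auto simp: free_semigroup_def)
  ultimately show ?thesis
    unfolding free_subsemigroup_def mult
    by (blast intro: inj_on_imp_bij_betw word_matrix_append)
qed

section \<open>Matrices over a locally finite field\<close>

lemma finite_mats_with_entries_in:
  assumes "finite F"
  shows "finite {A \<in> carrier_mat n m. \<forall>i<n. \<forall>j<m. A $$ (i, j) \<in> F}"
proof -
  let ?I = "{..<n} \<times> {..<m}"
  let ?M = "{A \<in> carrier_mat n m. \<forall>i<n. \<forall>j<m. A $$ (i, j) \<in> F}"
  have "finite (PiE ?I (\<lambda>_. F))" using assms by (intro finite_PiE) auto
  moreover have "?M \<subseteq> mat n m ` PiE ?I (\<lambda>_. F)"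
  proof
    fix A assume A: "A \<in> ?M"
    have "A = mat n m (restrict (($$) A) ?I)" using A by (auto intro: eq_matI)
    moreover have "restrict (($$) A) ?I \<in> PiE ?I (\<lambda>_. F)" using A by auto
    ultimately show "A \<in> mat n m ` PiE ?I (\<lambda>_. F)" by blast
  qed
  ultimately show ?thesis using finite_subset by blast
qed

lemma no_free_subsemigroup_if_locally_finite:
  assumes lf: "locally_finite_field (ring_of_type_algebra :: 'k::field ring)"
  shows "\<not> free_subsemigroup 2 T (UT TYPE('k) 2)"
proof
  assume free: "free_subsemigroup 2 T (UT TYPE('k) 2)"
  have UT: "carrier (UT TYPE('k) 2) \<subseteq> carrier_mat 2 2"
    "A \<otimes>\<^bsub>UT TYPE('k) 2\<^esub> B = A * B" for A B
    by (auto simp: UT_def)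
  from free obtain \<phi> :: "nat list \<Rightarrow> 'k mat" where T: "T \<subseteq> carrier_mat 2 2"
    and bij: "bij_betw \<phi> (free_semigroup {..<2}) T"
    and hom: "\<And>u v. u \<in> free_semigroup {..<2} \<Longrightarrow> v \<in> free_semigroup {..<2} \<Longrightarrow>
      \<phi> (u @ v) = \<phi> u * \<phi> v"
    unfolding free_subsemigroup_def subsemigroup_def UT(2) using UT(1) by blast
  define w where "w n = replicate (Suc n) (0 :: nat)" for n
  have w: "w n \<in> free_semigroup {..<2}" for n
    by (auto simp: w_def free_semigroup_def)
  have dim: "\<phi> (w n) \<in> carrier_mat 2 2" for n
    using T bij w by (auto simp: bij_betw_def)
  let ?K = "ring_of_type_algebra :: 'k ring"
  define S where "S = {\<phi> (w 0) $$ (i, j) | i j. i < 2 \<and> j < 2}"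
  define F where "F = generate_field ?K S"
  have "S = (\<lambda>(i, j). \<phi> (w 0) $$ (i, j)) ` ({..<2} \<times> {..<2})"
    by (auto simp: S_def image_def)
  then have "finite S" by simp
  then have "finite F" using lf
    by (auto simp: locally_finite_field_def F_def ring_of_type_algebra_def)
  have F_add: "x + y \<in> F" and F_mult: "x * y \<in> F" if "x \<in> F" "y \<in> F" for x y
    using generate_field.eng_add[of x ?K S y] generate_field.eng_mult[of x ?K S y] that
    by (auto simp: F_def ring_of_type_algebra_def)
  have base: "\<forall>i<2. \<forall>j<2. \<phi> (w 0) $$ (i, j) \<in> F"
    unfolding F_def by (auto simp: S_def intro!: generate_field.incl)
  have entries: "\<forall>i<2. \<forall>j<2. \<phi> (w n) $$ (i, j) \<in> F" for n
  proof (induction n)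
    case 0
    show ?case by (rule base)
  next
    case (Suc n)
    have "w (Suc n) = w 0 @ w n" by (simp add: w_def)
    then have "\<phi> (w (Suc n)) = \<phi> (w 0) * \<phi> (w n)" using hom w by metis
    moreover have "(\<phi> (w 0) * \<phi> (w n)) $$ (i, j) =
        \<phi> (w 0) $$ (i, 0) * \<phi> (w n) $$ (0, j) + \<phi> (w 0) $$ (i, 1) * \<phi> (w n) $$ (1, j)"
      if "i < 2" "j < 2" for i j
      using index_mult_mat_2[OF dim dim that] .
    ultimately show ?case
      using base Suc.IH by (auto intro!: F_add F_mult)
  qed
  have "range (\<lambda>n. \<phi> (w n)) \<subseteq> {A \<in> carrier_mat 2 2. \<forall>i<2. \<forall>j<2. A $$ (i, j) \<in> F}"
    using entries dim by blast
  then have "finite (range (\<lambda>n. \<phi> (w n)))"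
    using finite_mats_with_entries_in[OF \<open>finite F\<close>] finite_subset by blast
  moreover have "inj (\<lambda>n. \<phi> (w n))"
  proof (rule injI)
    fix m n assume "\<phi> (w m) = \<phi> (w n)"
    then have "w m = w n" using bij w by (meson bij_betw_imp_inj_on inj_onD)
    then show "m = n" by (auto simp: w_def dest: arg_cong[of _ _ length])
  qed
  ultimately show False using finite_imageD by blast
qed

theorem corollary4p5:
  shows "(\<exists>T. free_subsemigroup 2 T (UT TYPE('k::field) 2)) \<longleftrightarrow>
         \<not> locally_finite_field (ring_of_type_algebra :: 'k ring)"
  using no_free_subsemigroup_if_locally_finite free_subsemigroup_if_not_signed_binary_root
    locally_finite_if_all_signed_binary_roots
  by metis

end
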